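(* For every $s\ge 0$ and every $\omega\in\Omega^*$, $P_s^*\psi_\omega = \psi_{\tau^s\omega}$; that is, $\psi_\omega(P_s f) = \psi_{\tau^s\omega}(f)$ for all $f\in L^\infty([1,\infty))$.
   Context: $L^\infty([1,\infty))$ is the space of real essentially bounded measurable functions on $[1,\infty)$. For $s\ge0$, $P_s: L^\infty([1,\infty))\to L^\infty([1,\infty))$ is $(P_sf)(x)=f(2^s x)$ and $P_s^*$ its adjoint. For an ultrafilter $\eta$ on $\mathbb{N}$ and a bounded sequence $a_n$, $\eta\text{-}\lim_n a_n$ is the unique $\alpha$ with $\{n:|a_n-\alpha|<\varepsilon\}\in\eta$ for every $\varepsilon>0$. Let $\mathbb{N}^*$ be the set of free ultrafilters on $\mathbb{N}$ (the remainder of the Stone–Čech compactification $\beta\mathbb{N}$), and $\tau$ the continuous extension to $\beta\mathbb{N}$ of $n\mapsto n+1$, i.e. $\tau\eta=\{S : \{n: n+1\in S\}\in\eta\}$. $\Omega$ is the quotient of $\beta\mathbb{N}\times[0,1]$ identifying $(\eta,1)$ with $(\tau\eta,0)$, and $\Omega^*$ the closed subspace of classes $(\eta,t)$ with $\eta\in\mathbb{N}^*$. The flow $\tau^s$ ($s\in\mathbb{R}$) on $\Omega^*$ is $\tau^s(\eta,t)=(\tau^{[t+s]}\eta,\ t+s-[t+s])$, $[x]$ the integer part. For $\omega=(\eta,t)\in\Omega^*$ with $\theta=2^t$, $\psi_\omega(f)=\eta\text{-}\lim_n \frac{1}{\theta 2^n}\int_1^{\theta 2^n} f(y)\,dy$.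 *)

theory Defs
  imports "HOL-Analysis.Analysis" "HOL-Probability.Essential_Supremum"
begin

section \<open>The space of essentially bounded functions on the half-line\<close>

abbreviation half_line :: "real measure"
  where "half_line \<equiv> lebesgue_on {1..}"

definition ess_bounded :: "(real \<Rightarrow> real) \<Rightarrow> bool"
  where "ess_bounded f \<longleftrightarrow>
    f \<in> borel_measurable half_line \<and> (\<exists>C. AE x in half_line. \<bar>f x\<bar> \<le> C)"

text \<open>Elements of \<open>linf\<close> are classes of functions modulo equality almost everywhere on
  \<open>[1,\<infinity>)\<close>; values of a representative outside \<open>[1,\<infinity>)\<close> are irrelevant.\<close>

definition ae_eq :: "(real \<Rightarrow> real) \<Rightarrow> (real \<Rightarrow> real) \<Rightarrow> bool"
  where "ae_eq f g \<longleftrightarrow> ess_bounded f \<and> ess_bounded g \<and> (AE x in half_line. f x = g x)"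

lemma ess_bounded_const: "ess_bounded (\<lambda>x. c)"
  unfolding ess_bounded_def by (auto intro!: exI[of _ "\<bar>c\<bar>"])

lemma part_equivp_ae_eq: "part_equivp ae_eq"
proof (rule part_equivpI)
  show "\<exists>f. ae_eq f f"
    by (rule exI[of _ "\<lambda>x. 0"]) (simp add: ae_eq_def ess_bounded_const)
  show "symp ae_eq"
    by (auto simp: symp_def ae_eq_def elim!: eventually_mono)
  show "transp ae_eq"
  proof (rule transpI)
    fix f g h assume a: "ae_eq f g" "ae_eq g h"
    have "AE x in half_line. f x = g x" "AE x in half_line. g x = h x"
      using a by (auto simp: ae_eq_def)
    then have "AE x in half_line. f x = h x" by eventually_elim simp
    then show "ae_eq f h" using a by (simp add: ae_eq_def)
  qed
qed

quotient_type linf = "real \<Rightarrow> real" / partial: ae_eq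
  morphisms rep_linf linf_of
  by (rule part_equivp_ae_eq)

lemma ess_bounded_add:
  assumes "ess_bounded f" "ess_bounded g"
  shows "ess_bounded (\<lambda>x. f x + g x)"
proof -
  obtain C D where
    "AE x in half_line. \<bar>f x\<bar> \<le> C" "AE x in half_line. \<bar>g x\<bar> \<le> D"
    using assms by (auto simp: ess_bounded_def)
  then have "AE x in half_line. \<bar>f x + g x\<bar> \<le> C + D"
    by eventually_elim linarith
  then show ?thesis using assms by (auto simp: ess_bounded_def)
qed

lemma ess_bounded_cmult:
  assumes "ess_bounded f"
  shows "ess_bounded (\<lambda>x. c * f x)"
proof -
  obtain C where "AE x in half_line. \<bar>f x\<bar> \<le> C"
    using assms by (auto simp: ess_bounded_def)
  then have "AE x in half_line. \<bar>c * f x\<bar> \<le> \<bar>c\<bar> * C"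
    by eventually_elim (simp add: abs_mult mult_left_mono)
  then show ?thesis using assms by (auto simp: ess_bounded_def)
qed

lemma ess_bounded_uminus: "ess_bounded f \<Longrightarrow> ess_bounded (\<lambda>x. - f x)"
  using ess_bounded_cmult[of f "-1"] by simp

lemma ess_bounded_diff: "ess_bounded f \<Longrightarrow> ess_bounded g \<Longrightarrow> ess_bounded (\<lambda>x. f x - g x)"
  using ess_bounded_add[OF _ ess_bounded_uminus, of f g] by simp

lemma emeasure_half_line: "emeasure half_line (space half_line) \<noteq> 0"
proof -
  have "emeasure lebesgue {1..2::real} \<le> emeasure lebesgue {1::real..}"
    by (rule emeasure_mono) auto
  moreover have "emeasure lebesgue {1..2::real} = 1" by simp
  ultimately have "emeasure lebesgue {1::real..} \<noteq> 0" by force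
  then show ?thesis by (simp add: emeasure_restrict_space)
qed

lemma half_line_AE_False: "\<not> (AE x in half_line. False)"
proof
  assume "AE x in half_line. False"
  then have "ae_filter half_line = bot" by (simp add: trivial_limit_def)
  then show False using emeasure_half_line by (simp add: ae_filter_eq_bot_iff)
qed

definition ess_norm :: "(real \<Rightarrow> real) \<Rightarrow> real"
  where "ess_norm f = real_of_ereal (esssup half_line (\<lambda>x. ereal \<bar>f x\<bar>))"

lemma esssup_ess_norm:
  assumes "ess_bounded f"
  shows "esssup half_line (\<lambda>x. ereal \<bar>f x\<bar>) = ereal (ess_norm f)" "0 \<le> ess_norm f"
proof -
  let ?s = "esssup half_line (\<lambda>x. ereal \<bar>f x\<bar>)"
  obtain C where C: "AE x in half_line. \<bar>f x\<bar> \<le> C" and f: "f \<in> borel_measurable half_line"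
    using assms by (auto simp: ess_bounded_def)
  have le: "?s \<le> ereal C" by (rule esssup_I) (use C f in auto)
  have ge: "0 \<le> ?s"
  proof (rule ccontr)
    assume n: "\<not> 0 \<le> ?s"
    have "AE x in half_line. ereal \<bar>f x\<bar> \<le> ?s" by (rule esssup_AE)
    then have "AE x in half_line. False"
    proof eventually_elim
      fix x assume "ereal \<bar>f x\<bar> \<le> ?s"
      moreover have "0 \<le> ereal \<bar>f x\<bar>" by simp
      ultimately show False using n order_trans by blast
    qed
    then show False using half_line_AE_False by simp
  qed
  show "?s = ereal (ess_norm f)"
    using le ge unfolding ess_norm_def by (cases ?s) auto
  then show "0 \<le> ess_norm f" using ge by simp
qed

lemma ess_norm_AE:
  assumes "ess_bounded f"
  shows "AE x in half_line. \<bar>f x\<bar> \<le> ess_norm f"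
  using esssup_AE[of "\<lambda>x. ereal \<bar>f x\<bar>" half_line] esssup_ess_norm(1)[OF assms] by simp

lemma ess_norm_le:
  assumes "ess_bounded f" "AE x in half_line. \<bar>f x\<bar> \<le> C"
  shows "ess_norm f \<le> C"
proof -
  have "esssup half_line (\<lambda>x. ereal \<bar>f x\<bar>) \<le> ereal C"
    by (rule esssup_I) (use assms in \<open>auto simp: ess_bounded_def\<close>)
  then show ?thesis using esssup_ess_norm(1)[OF assms(1)] by simp
qed

lemma ess_norm_cong: "ae_eq f g \<Longrightarrow> ess_norm f = ess_norm g"
  unfolding ess_norm_def
  by (rule arg_cong[where f = real_of_ereal], rule esssup_AE_cong)
     (auto simp: ae_eq_def ess_bounded_def)

lemma ess_norm_triangle:
  assumes "ess_bounded f" "ess_bounded g"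
  shows "ess_norm (\<lambda>x. f x + g x) \<le> ess_norm f + ess_norm g"
proof (rule ess_norm_le)
  show "AE x in half_line. \<bar>f x + g x\<bar> \<le> ess_norm f + ess_norm g"
    using ess_norm_AE[OF assms(1)] ess_norm_AE[OF assms(2)] by eventually_elim linarith
qed (simp add: ess_bounded_add assms)

lemma ess_norm_cmult_le:
  assumes "ess_bounded f"
  shows "ess_norm (\<lambda>x. c * f x) \<le> \<bar>c\<bar> * ess_norm f"
proof (rule ess_norm_le)
  show "AE x in half_line. \<bar>c * f x\<bar> \<le> \<bar>c\<bar> * ess_norm f"
    using ess_norm_AE[OF assms] by eventually_elim (simp add: abs_mult mult_left_mono)
qed (simp add: ess_bounded_cmult assms)

lemma ess_norm_cmult:
  assumes "ess_bounded f"
  shows "ess_norm (\<lambda>x. c * f x) = \<bar>c\<bar> * ess_norm f"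
proof (cases "c = 0")
  case True
  have "ess_norm (\<lambda>x. 0) \<le> 0" by (rule ess_norm_le) (auto simp: ess_bounded_const)
  then show ?thesis using True esssup_ess_norm(2)[OF ess_bounded_const[of 0]] by simp
next
  case False
  have "ess_norm (\<lambda>x. inverse c * (c * f x)) \<le> \<bar>inverse c\<bar> * ess_norm (\<lambda>x. c * f x)"
    by (rule ess_norm_cmult_le) (simp add: ess_bounded_cmult assms)
  moreover have "(\<lambda>x. inverse c * (c * f x)) = f" using False by auto
  ultimately have "\<bar>c\<bar> * ess_norm f \<le> ess_norm (\<lambda>x. c * f x)"
    using False by (simp add: field_simps)
  then show ?thesis using ess_norm_cmult_le[OF assms, of c] by linarith
qed

lemma ess_norm_eq_0:
  assumes "ess_bounded f"
  shows "ess_norm f = 0 \<longleftrightarrow> ae_eq f (\<lambda>x. 0)"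
proof
  assume "ess_norm f = 0"
  then show "ae_eq f (\<lambda>x. 0)"
    using ess_norm_AE[OF assms] assms ess_bounded_const by (auto simp: ae_eq_def)
next
  assume "ae_eq f (\<lambda>x. 0)"
  then have "ess_norm f = ess_norm (\<lambda>x. 0 * 0)" using ess_norm_cong by simp
  then show "ess_norm f = 0"
    using ess_norm_cmult[OF ess_bounded_const, of 0 0] by simp
qed

instantiation linf :: real_normed_vector
begin

lift_definition zero_linf :: linf is "\<lambda>x. 0"
  by (simp add: ae_eq_def ess_bounded_const)

lift_definition plus_linf :: "linf \<Rightarrow> linf \<Rightarrow> linf" is "\<lambda>f g x. f x + g x"
  by (auto simp: ae_eq_def ess_bounded_add elim: eventually_elim2)

lift_definition minus_linf :: "linf \<Rightarrow> linf \<Rightarrow> linf" is "\<lambda>f g x. f x - g x"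
  by (auto simp: ae_eq_def ess_bounded_diff elim: eventually_elim2)

lift_definition uminus_linf :: "linf \<Rightarrow> linf" is "\<lambda>f x. - f x"
  by (auto simp: ae_eq_def ess_bounded_uminus)

lift_definition scaleR_linf :: "real \<Rightarrow> linf \<Rightarrow> linf" is "\<lambda>c f x. c * f x"
  by (auto simp: ae_eq_def ess_bounded_cmult elim: eventually_mono)

lift_definition norm_linf :: "linf \<Rightarrow> real" is ess_norm
  by (rule ess_norm_cong)

definition sgn_linf :: "linf \<Rightarrow> linf"
  where "sgn_linf f = inverse (norm f) *\<^sub>R f"

definition dist_linf :: "linf \<Rightarrow> linf \<Rightarrow> real"
  where "dist_linf f g = norm (f - g)"

definition uniformity_linf :: "(linf \<times> linf) filter"
  where "uniformity_linf = (INF e\<in>{0 <..}. principal {(x, y). dist x y < e})"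

definition open_linf :: "linf set \<Rightarrow> bool"
  where "open_linf S \<longleftrightarrow> (\<forall>x\<in>S. \<forall>\<^sub>F (x', y) in uniformity. x' = x \<longrightarrow> y \<in> S)"

instance
proof
  fix f g h :: linf and a b :: real
  show "f + g + h = f + (g + h)"
    by transfer (auto simp: ae_eq_def ess_bounded_add)
  show "f + g = g + f"
    by transfer (auto simp: ae_eq_def ess_bounded_add)
  show "0 + f = f"
    by transfer (auto simp: ae_eq_def ess_bounded_add)
  show "- f + f = 0"
    by transfer (auto simp: ae_eq_def ess_bounded_const)
  show "f - g = f + - g"
    by transfer (auto simp: ae_eq_def ess_bounded_diff)
  show "a *\<^sub>R (f + g) = a *\<^sub>R f + a *\<^sub>R g"
    by transfer (auto simp: ae_eq_def ess_bounded_cmult ess_bounded_add algebra_simps)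
  show "(a + b) *\<^sub>R f = a *\<^sub>R f + b *\<^sub>R f"
    by transfer (auto simp: ae_eq_def ess_bounded_cmult ess_bounded_add distrib_right)
  show "a *\<^sub>R b *\<^sub>R f = (a * b) *\<^sub>R f"
    by transfer (auto simp: ae_eq_def ess_bounded_cmult mult.assoc)
  show "1 *\<^sub>R f = f"
    by transfer (auto simp: ae_eq_def)
  show "(norm f = 0) = (f = 0)"
    by transfer (auto simp: ess_norm_eq_0 ae_eq_def)
  show "norm (f + g) \<le> norm f + norm g"
    by transfer (auto simp: ae_eq_def intro: ess_norm_triangle)
  show "norm (a *\<^sub>R f) = \<bar>a\<bar> * norm f"
    by transfer (auto simp: ae_eq_def intro: ess_norm_cmult)
qed (simp_all add: dist_linf_def sgn_linf_def uniformity_linf_def open_linf_def)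

end


section \<open>Dilations and adjoints\<close>

lemma AE_half_line_dilate:
  assumes "AE x in half_line. Q x" and c: "1 \<le> (c::real)"
  shows "AE x in half_line. Q (c * x)"
proof -
  have "AE x in lebesgue. x \<in> {1..} \<longrightarrow> Q x"
    using assms(1) by (simp add: AE_restrict_space_iff)
  then obtain N where N: "N \<in> null_sets lebesgue" "{x. \<not> (x \<in> {1..} \<longrightarrow> Q x)} \<subseteq> N"
    unfolding eventually_ae_filter by auto
  have T: "(\<lambda>x. c * x) \<in> lebesgue \<rightarrow>\<^sub>M lebesgue"
    using lebesgue_measurable_scaling[of c, where 'a = real] by (simp add: real_scaleR_def[abs_def])
  have "AE x in lebesgue. x \<notin> N" using N(1) by (rule AE_not_in)
  then have "AE x in density (distr lebesgue lebesgue (\<lambda>x. c * x)) (\<lambda>x. ennreal \<bar>c\<bar>). x \<notin> N"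
    using c by (subst lebesgue_real_scale[symmetric]) auto
  then have "AE x in distr lebesgue lebesgue (\<lambda>x. c * x). x \<notin> N"
    using c by (simp add: AE_density)
  moreover have "{x \<in> space lebesgue. x \<notin> N} \<in> sets lebesgue"
    using N(1) by (auto simp: Collect_neg_eq Compl_in_sets_lebesgue dest: null_setsD2)
  ultimately have "AE x in lebesgue. c * x \<notin> N"
    using T by (subst (asm) AE_distr_iff) auto
  then have "AE x in lebesgue. x \<in> {1..} \<longrightarrow> Q (c * x)"
  proof eventually_elim
    fix x assume x: "c * x \<notin> N"
    show "x \<in> {1..} \<longrightarrow> Q (c * x)"
    proof
      assume "x \<in> {1..}"
      then have "1 * 1 \<le> c * x" using c by (intro mult_mono) auto
      then show "Q (c * x)" using x N(2) by auto
    qed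
  qed
  then show ?thesis by (simp add: AE_restrict_space_iff)
qed

lemma measurable_half_line_dilate:
  assumes "f \<in> borel_measurable half_line" and c: "1 \<le> (c::real)"
  shows "(\<lambda>x. f (c * x)) \<in> borel_measurable half_line"
proof (rule measurable_compose[OF _ assms(1)])
  have "(\<lambda>x. c * x) \<in> lebesgue \<rightarrow>\<^sub>M lebesgue"
    using lebesgue_measurable_scaling[of c, where 'a = real] by (simp add: real_scaleR_def[abs_def])
  then have "(\<lambda>x. c * x) \<in> half_line \<rightarrow>\<^sub>M lebesgue" by (rule measurable_restrict_space1)
  moreover have "c * x \<in> {1..}" if "x \<in> {1..}" for x
    using mult_mono[of 1 c 1 x] that c by auto
  ultimately show "(\<lambda>x. c * x) \<in> half_line \<rightarrow>\<^sub>M half_line"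
    by (auto intro!: measurable_restrict_space2)
qed

lemma ess_bounded_dilate:
  assumes "ess_bounded f" "1 \<le> c"
  shows "ess_bounded (\<lambda>x. f (c * x))"
proof -
  obtain C where "AE x in half_line. \<bar>f x\<bar> \<le> C"
    using assms by (auto simp: ess_bounded_def)
  then have "AE x in half_line. \<bar>f (c * x)\<bar> \<le> C"
    using assms(2) by (rule AE_half_line_dilate)
  then show ?thesis
    using assms measurable_half_line_dilate by (auto simp: ess_bounded_def)
qed

text \<open>Dilations are only meaningful for \<open>s \<ge> 0\<close>; for \<open>s < 0\<close> the value is \<open>0\<close> by convention.\<close>

lift_definition dilate :: "real \<Rightarrow> linf \<Rightarrow> linf"
  is "\<lambda>s f x. if 0 \<le> s then f (2 powr s * x) else 0"
proof -
  fix s and f g :: "real \<Rightarrow> real" assume fg: "ae_eq f g"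
  have c: "1 \<le> (2::real) powr s" if "0 \<le> s" using that by (simp add: ge_one_powr_ge_zero)
  show "ae_eq (\<lambda>x. if 0 \<le> s then f (2 powr s * x) else 0)
      (\<lambda>x. if 0 \<le> s then g (2 powr s * x) else 0)"
    using fg c AE_half_line_dilate[of "\<lambda>x. f x = g x" "2 powr s"]
    by (cases "0 \<le> s") (auto simp: ae_eq_def ess_bounded_dilate ess_bounded_const)
qed

lemma norm_dilate_le: "norm (dilate s f) \<le> norm f"
proof (transfer fixing: s, goal_cases)
  case (1 f)
  have c: "1 \<le> (2::real) powr s" if "0 \<le> s" using that by (simp add: ge_one_powr_ge_zero)
  have f: "ess_bounded f" using 1 by (simp add: ae_eq_def)
  show ?case
  proof (cases "0 \<le> s")
    case True
    then show ?thesis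
      using AE_half_line_dilate[OF ess_norm_AE[OF f] c] f c
      by (auto intro!: ess_norm_le ess_bounded_dilate)
  next
    case False
    then show ?thesis
      using esssup_ess_norm(2)[OF f] by (auto intro!: ess_norm_le ess_bounded_const)
  qed
qed

lift_definition P :: "real \<Rightarrow> linf \<Rightarrow>\<^sub>L linf" is dilate
proof (rule bounded_linear_intro[where K = 1])
  fix s r :: real and f g :: linf
  have c: "1 \<le> (2::real) powr s" if "0 \<le> s" using that by (simp add: ge_one_powr_ge_zero)
  show "dilate s (f + g) = dilate s f + dilate s g"
    by (cases "0 \<le> s"; transfer fixing: s)
      (auto simp: ae_eq_def ess_bounded_add ess_bounded_dilate ess_bounded_const c)
  show "dilate s (r *\<^sub>R f) = r *\<^sub>R dilate s f"
    by (cases "0 \<le> s"; transfer fixing: s r)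
      (auto simp: ae_eq_def ess_bounded_cmult ess_bounded_dilate ess_bounded_const c)
  show "norm (dilate s f) \<le> norm f * 1"
    using norm_dilate_le by simp
qed

lemma P_linf_of:
  assumes "ess_bounded f" "0 \<le> s"
  shows "P s (linf_of f) = linf_of (\<lambda>x. f (2 powr s * x))"
  using assms by (simp add: P.rep_eq dilate.abs_eq ae_eq_def)

definition dual_adjoint :: "('a::real_normed_vector \<Rightarrow>\<^sub>L 'b::real_normed_vector) \<Rightarrow>
    ('b \<Rightarrow>\<^sub>L real) \<Rightarrow> ('a \<Rightarrow>\<^sub>L real)"
  where "dual_adjoint T \<phi> = \<phi> o\<^sub>L T"


section \<open>Ultrafilters on the natural numbers\<close>

text \<open>An ultrafilter is represented as a filter of the library; \<open>S \<in> \<eta>\<close> reads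
  \<open>eventually (\<lambda>n. n \<in> S) \<eta>\<close>. The filter \<open>bot\<close> is the improper one.\<close>

definition is_ultrafilter :: "nat filter \<Rightarrow> bool"
  where "is_ultrafilter F \<longleftrightarrow>
    F \<noteq> bot \<and> (\<forall>S. eventually (\<lambda>n. n \<in> S) F \<or> eventually (\<lambda>n. n \<in> - S) F)"

lemma is_ultrafilter_principal: "is_ultrafilter (principal {n})"
  by (auto simp: is_ultrafilter_def eventually_principal principal_eq_bot_iff)

typedef betaN = "{F. is_ultrafilter F}"
  morphisms filter_of Abs_betaN
  using is_ultrafilter_principal by blast

setup_lifting type_definition_betaN

lift_definition principal_ultrafilter :: "nat \<Rightarrow> betaN" is "\<lambda>n. principal {n}"
  by (rule is_ultrafilter_principal)

definition free_ultrafilters :: "betaN set"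
  where "free_ultrafilters = - range principal_ultrafilter"

lemma is_ultrafilter_filtermap:
  assumes "is_ultrafilter F"
  shows "is_ultrafilter (filtermap h F)"
proof -
  have "eventually (\<lambda>n. h n \<in> S) F \<or> eventually (\<lambda>n. h n \<in> - S) F" for S
    using assms[unfolded is_ultrafilter_def, THEN conjunct2, rule_format, of "h -` S"]
    by simp
  then show ?thesis
    using assms by (auto simp: is_ultrafilter_def eventually_filtermap filtermap_bot_iff)
qed

lift_definition tau :: "betaN \<Rightarrow> betaN" is "filtermap Suc"
  by (rule is_ultrafilter_filtermap)

lemma eventually_tau: "eventually (\<lambda>n. n \<in> S) (filter_of (tau \<eta>)) \<longleftrightarrow>
    eventually (\<lambda>n. n + 1 \<in> S) (filter_of \<eta>)"
  by (simp add: tau.rep_eq eventually_filtermap)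

lemma inj_tau: "inj tau"
proof (rule injI)
  fix \<eta> \<xi> assume "tau \<eta> = tau \<xi>"
  then have "filtermap Suc (filter_of \<eta>) = filtermap Suc (filter_of \<xi>)"
    by (metis tau.rep_eq)
  then have "filter_of \<eta> = filter_of \<xi>"
    by (simp add: filtermap_eq_strong)
  then show "\<eta> = \<xi>" by (simp add: filter_of_inject)
qed

text \<open>Integer powers of \<open>tau\<close>. On the free ultrafilters \<open>tau\<close> is a bijection, so there
  \<open>inv tau\<close> is its two-sided inverse; on \<open>betaN\<close> it is only a left inverse.\<close>

definition tau_power :: "int \<Rightarrow> betaN \<Rightarrow> betaN"
  where "tau_power k = (if 0 \<le> k then tau ^^ nat k else inv tau ^^ nat (- k))"

lemma bij_tau_free: "bij_betw tau free_ultrafilters free_ultrafilters"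
proof -
  have fr: "\<eta> \<in> free_ultrafilters \<longleftrightarrow> (\<forall>n. eventually (\<lambda>k. k \<noteq> n) (filter_of \<eta>))" for \<eta>
  proof -
    have u: "is_ultrafilter (filter_of \<eta>)" using filter_of[of \<eta>] by simp
    have "(\<eta> = principal_ultrafilter n) \<longleftrightarrow> \<not> eventually (\<lambda>k. k \<noteq> n) (filter_of \<eta>)" for n
    proof
      assume "\<eta> = principal_ultrafilter n"
      then show "\<not> eventually (\<lambda>k. k \<noteq> n) (filter_of \<eta>)"
        by (simp add: principal_ultrafilter.rep_eq eventually_principal)
    next
      assume "\<not> eventually (\<lambda>k. k \<noteq> n) (filter_of \<eta>)"
      then have n: "eventually (\<lambda>k. k = n) (filter_of \<eta>)"
        using u[unfolded is_ultrafilter_def, THEN conjunct2, rule_format, of "{n}"] by simp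
      have "filter_of \<eta> = principal {n}"
      proof (rule antisym)
        show "filter_of \<eta> \<le> principal {n}" using n by (simp add: le_principal)
        show "principal {n} \<le> filter_of \<eta>"
        proof (rule filter_leI)
          fix Q assume "eventually Q (filter_of \<eta>)"
          then have "eventually (\<lambda>k. Q n) (filter_of \<eta>)"
            using n by eventually_elim simp
          then show "eventually Q (principal {n})"
            using u by (cases "Q n") (auto simp: is_ultrafilter_def eventually_principal eventually_False)
        qed
      qed
      then show "\<eta> = principal_ultrafilter n"
        by (metis filter_of_inject principal_ultrafilter.rep_eq)
    qed
    then show ?thesis by (auto simp: free_ultrafilters_def)
  qed
  have "tau \<eta> \<in> free_ultrafilters" if "\<eta> \<in> free_ultrafilters" for \<eta>
    unfolding fr
  proof
    fix n
    show "eventually (\<lambda>k. k \<noteq> n) (filter_of (tau \<eta>))"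
      using that[unfolded fr] by (cases n) (auto simp: tau.rep_eq eventually_filtermap)
  qed
  moreover have "\<xi> \<in> tau ` free_ultrafilters" if x: "\<xi> \<in> free_ultrafilters" for \<xi>
  proof -
    define \<eta> where "\<eta> = Abs_betaN (filtermap (\<lambda>n. n - 1) (filter_of \<xi>))"
    have rep: "filter_of \<eta> = filtermap (\<lambda>n. n - 1) (filter_of \<xi>)"
      unfolding \<eta>_def using filter_of[of \<xi>]
      by (intro Abs_betaN_inverse) (simp add: is_ultrafilter_filtermap)
    have nz: "eventually (\<lambda>k. k \<noteq> 0) (filter_of \<xi>)" using x fr by blast
    have "filtermap Suc (filter_of \<eta>) = filtermap (\<lambda>n. Suc (n - 1)) (filter_of \<xi>)"
      by (simp add: rep filtermap_filtermap)
    also have "\<dots> = filtermap (\<lambda>n. n) (filter_of \<xi>)"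
    proof (rule filter_eqI)
      fix Q
      have eq: "eventually (\<lambda>n. Suc (n - 1) = n) (filter_of \<xi>)"
        using nz by eventually_elim simp
      show "eventually Q (filtermap (\<lambda>n. Suc (n - 1)) (filter_of \<xi>)) \<longleftrightarrow>
          eventually Q (filtermap (\<lambda>n. n) (filter_of \<xi>))"
        unfolding eventually_filtermap
        by (rule eventually_cong) (use eq in \<open>auto elim: eventually_mono\<close>)
    qed
    finally have "tau \<eta> = \<xi>"
      by (simp add: filter_of_inject[symmetric] tau.rep_eq filtermap_ident)
    moreover have "\<eta> \<in> free_ultrafilters" unfolding fr
    proof
      fix n
      have "eventually (\<lambda>k. k \<noteq> Suc n) (filter_of \<xi>)" using x fr by blast
      with nz show "eventually (\<lambda>k. k \<noteq> n) (filter_of \<eta>)"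
        unfolding rep eventually_filtermap by eventually_elim auto
    qed
    ultimately show ?thesis by blast
  qed
  ultimately show ?thesis
    using inj_tau by (auto simp: bij_betw_def intro: inj_on_subset)
qed

lemma tau_power_free:
  assumes "\<eta> \<in> free_ultrafilters"
  shows "tau_power k \<eta> \<in> free_ultrafilters"
proof -
  have t: "tau \<xi> \<in> free_ultrafilters" "inv tau \<xi> \<in> free_ultrafilters"
    if "\<xi> \<in> free_ultrafilters" for \<xi>
    using that bij_tau_free inv_f_f[OF inj_tau] unfolding bij_betw_def by (auto, metis imageE)
  have "(tau ^^ n) \<eta> \<in> free_ultrafilters" "(inv tau ^^ n) \<eta> \<in> free_ultrafilters" for n
    using assms t by (induction n) auto
  then show ?thesis by (simp add: tau_power_def)
qed

lemma tau_power_shift: "tau_power (k + 1) \<eta> = tau_power k (tau \<eta>)"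
proof -
  consider "0 \<le> k" | "k = - 1" | m where "k = - 2 - int m"
  proof (cases "k \<le> - 2")
    case True
    then have "k = - 2 - int (nat (- 2 - k))" by simp
    then show ?thesis using that(3) by blast
  next
    case False
    then show ?thesis using that(1,2) by linarith
  qed
  then show ?thesis
  proof cases
    case 1
    then show ?thesis by (simp add: tau_power_def nat_add_distrib funpow_swap1)
  next
    case 2
    then show ?thesis by (simp add: tau_power_def inv_f_f[OF inj_tau])
  next
    case 3
    then have "nat (- k) = Suc (Suc m)" "nat (- (k + 1)) = Suc m" by auto
    then show ?thesis using 3
      by (simp add: tau_power_def funpow_swap1 inv_f_f[OF inj_tau])
  qed
qed

text \<open>The limit of a bounded sequence along an ultrafilter, via the library's \<^const>\<open>Lim\<close>,
  which is the unique limit (\<open>eta_lim_eqI\<close>, \<open>eta_lim\<close>).\<close>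

definition eta_lim :: "betaN \<Rightarrow> (nat \<Rightarrow> real) \<Rightarrow> real"
  where "eta_lim \<eta> a = Lim (filter_of \<eta>) a"

lemma filter_of_neq_bot: "filter_of \<eta> \<noteq> bot"
  using filter_of[of \<eta>] by (simp add: is_ultrafilter_def)

lemma eta_lim_eqI_tendsto: "(a \<longlongrightarrow> l) (filter_of \<eta>) \<Longrightarrow> eta_lim \<eta> a = l"
  unfolding eta_lim_def by (rule tendsto_Lim) (simp_all add: filter_of_neq_bot)

lemma eta_lim_eqI:
  assumes "\<And>\<epsilon>. 0 < \<epsilon> \<Longrightarrow> eventually (\<lambda>n. n \<in> {n. \<bar>a n - l\<bar> < \<epsilon>}) (filter_of \<eta>)"
  shows "eta_lim \<eta> a = l"
  by (rule eta_lim_eqI_tendsto) (use assms in \<open>auto simp: tendsto_iff dist_real_def\<close>)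

lemma tendsto_eta_lim:
  assumes "\<And>n. \<bar>a n\<bar> \<le> C"
  shows "(a \<longlongrightarrow> eta_lim \<eta> a) (filter_of \<eta>)"
proof -
  let ?F = "filtermap a (filter_of \<eta>)"
  have "?F \<noteq> bot" by (simp add: filtermap_bot_iff filter_of_neq_bot)
  moreover have "eventually (\<lambda>x. x \<in> {-C..C}) ?F"
    using assms by (auto simp: eventually_filtermap abs_le_iff intro!: always_eventually)
      (metis minus_le_iff)
  ultimately obtain l where l: "inf (nhds l) ?F \<noteq> bot"
    using compact_Icc[of "-C" C] unfolding compact_filter by blast
  have "(a \<longlongrightarrow> l) (filter_of \<eta>)"
  proof (rule topological_tendstoI, rule ccontr)
    fix S assume S: "open S" "l \<in> S" and n: "\<not> eventually (\<lambda>x. a x \<in> S) (filter_of \<eta>)"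
    have "eventually (\<lambda>x. a x \<notin> S) (filter_of \<eta>)"
      using filter_of[of \<eta>] n unfolding mem_Collect_eq is_ultrafilter_def
      by (drule_tac conjunct2, drule_tac x = "a -` S" in spec) simp
    then have "eventually (\<lambda>x. x \<notin> S) ?F" by (simp add: eventually_filtermap)
    moreover have "eventually (\<lambda>x. x \<in> S) (nhds l)" using S by (rule eventually_nhds_in_open)
    ultimately have "eventually (\<lambda>x. False) (inf (nhds l) ?F)"
      unfolding eventually_inf by blast
    then show False using l by (simp add: eventually_False)
  qed
  then show ?thesis using eta_lim_eqI_tendsto by simp
qed

lemma eta_lim:
  assumes "\<And>n. \<bar>a n\<bar> \<le> C" "0 < \<epsilon>"
  shows "eventually (\<lambda>n. n \<in> {n. \<bar>a n - eta_lim \<eta> a\<bar> < \<epsilon>}) (filter_of \<eta>)"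
  using tendsto_eta_lim[OF assms(1), where \<eta> = \<eta>] assms(2) by (auto simp: tendsto_iff dist_real_def)

lemma eta_lim_tau: "eta_lim (tau \<eta>) a = eta_lim \<eta> (\<lambda>n. a (Suc n))"
  unfolding eta_lim_def Topological_Spaces.Lim_def tau.rep_eq filterlim_filtermap ..


section \<open>The suspension and its flow\<close>

text \<open>The equivalence relation generated by \<open>(\<eta>, 1) \<sim> (tau \<eta>, 0)\<close> on \<open>betaN \<times> [0,1]\<close>.\<close>

inductive glue :: "betaN \<times> real \<Rightarrow> betaN \<times> real \<Rightarrow> bool"
  where "glue (\<eta>, 1) (tau \<eta>, 0)"

definition Omega_rel :: "betaN \<times> real \<Rightarrow> betaN \<times> real \<Rightarrow> bool"
  where "Omega_rel p q \<longleftrightarrow>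
    p \<in> UNIV \<times> {0..1} \<and> q \<in> UNIV \<times> {0..1} \<and> equivclp glue p q"

lemma part_equivp_Omega_rel: "part_equivp Omega_rel"
proof (rule part_equivpI)
  show "\<exists>p. Omega_rel p p"
    by (rule exI[of _ "(principal_ultrafilter 0, 0)"]) (simp add: Omega_rel_def)
  show "symp Omega_rel"
    by (auto simp: symp_def Omega_rel_def intro: equivclp_sym)
  show "transp Omega_rel"
    by (auto simp: transp_def Omega_rel_def intro: equivclp_trans)
qed

quotient_type Omega = "betaN \<times> real" / partial: Omega_rel
  morphisms rep_Omega Omega_class
  by (rule part_equivp_Omega_rel)

lemma Omega_rel_invariant:
  assumes "Omega_rel p q" "\<And>\<eta>. h (\<eta>, 1) = h (tau \<eta>, 0)"
  shows "h p = h q"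
proof -
  have "equivclp glue p q" using assms(1) by (simp add: Omega_rel_def)
  then show ?thesis
    by (induction rule: equivclp_induct) (auto elim!: glue.cases simp: assms(2))
qed

definition Omega_star :: "Omega set"
  where "Omega_star = Omega_class ` (free_ultrafilters \<times> {0..1})"

text \<open>The flow is meant on \<open>Omega_star\<close>; the formula also makes sense on all of \<open>Omega\<close>,
  where for \<open>s < 0\<close> it depends on the values of \<open>inv tau\<close> outside the range of \<open>tau\<close>.\<close>

lift_definition flow :: "real \<Rightarrow> Omega \<Rightarrow> Omega"
  is "\<lambda>s (\<eta>, t). (tau_power \<lfloor>t + s\<rfloor> \<eta>, t + s - of_int \<lfloor>t + s\<rfloor>)"
proof -
  fix s :: real and p q assume pq: "Omega_rel p q"
  define h where "h = (\<lambda>(\<eta>, t :: real). (tau_power \<lfloor>t + s\<rfloor> \<eta>, t + s - of_int \<lfloor>t + s\<rfloor> :: real))"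
  have "h (\<eta>, 1) = h (tau \<eta>, 0)" for \<eta>
  proof -
    have "\<lfloor>1 + s\<rfloor> = \<lfloor>s\<rfloor> + 1" by linarith
    then show ?thesis by (simp add: h_def tau_power_shift[symmetric] add.commute)
  qed
  then have "h p = h q" by (rule Omega_rel_invariant[OF pq])
  moreover have "snd (h p) \<in> {0..1}"
    by (cases p) (simp add: h_def, linarith)
  ultimately have "Omega_rel (h p) (h q)" by (simp add: Omega_rel_def mem_Times_iff)
  then show "Omega_rel (case p of (\<eta>, t) \<Rightarrow> (tau_power \<lfloor>t + s\<rfloor> \<eta>, t + s - of_int \<lfloor>t + s\<rfloor>))
      (case q of (\<eta>, t) \<Rightarrow> (tau_power \<lfloor>t + s\<rfloor> \<eta>, t + s - of_int \<lfloor>t + s\<rfloor>))"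
    by (simp add: h_def)
qed


lemma flow_Omega_class:
  assumes "t \<in> {0..1}"
  shows "flow s (Omega_class (\<eta>, t)) =
    Omega_class (tau_power \<lfloor>t + s\<rfloor> \<eta>, t + s - of_int \<lfloor>t + s\<rfloor>)"
  using assms by (simp add: flow.abs_eq Omega_rel_def)

lemma flow_Omega_star:
  assumes "\<omega> \<in> Omega_star"
  shows "flow s \<omega> \<in> Omega_star"
proof -
  obtain \<eta> t where w: "\<omega> = Omega_class (\<eta>, t)" "\<eta> \<in> free_ultrafilters" "t \<in> {0..1}"
    using assms by (auto simp: Omega_star_def)
  have "t + s - of_int \<lfloor>t + s\<rfloor> \<in> {0..1}" by (simp, linarith)
  then show ?thesis
    using w by (auto simp: flow_Omega_class Omega_star_def intro!: imageI tau_power_free)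
qed


section \<open>The functionals\<close>

lemma measurable_indicator_half_line:
  assumes "f \<in> borel_measurable half_line"
  shows "(\<lambda>x. indicator {1..X} x *\<^sub>R f x :: real) \<in> borel_measurable lebesgue"
proof -
  have "f \<in> borel_measurable (lebesgue_on {1..X})"
    using assms by (rule measurable_restrict_mono) auto
  then show ?thesis
    by (subst (asm) borel_measurable_restrict_space_iff) auto
qed

lift_definition mean :: "real \<Rightarrow> linf \<Rightarrow> real"
  is "\<lambda>X f. 1 / X * (LINT y:{1..X}|lebesgue. f y)"
proof -
  fix X and f g :: "real \<Rightarrow> real" assume fg: "ae_eq f g"
  then have "AE x in lebesgue. x \<in> {1..} \<longrightarrow> f x = g x"
    by (simp add: ae_eq_def AE_restrict_space_iff)
  moreover have "f \<in> borel_measurable half_line" "g \<in> borel_measurable half_line"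
    using fg by (auto simp: ae_eq_def ess_bounded_def)
  ultimately have "(LINT y:{1..X}|lebesgue. f y) = (LINT y:{1..X}|lebesgue. g y)"
    unfolding set_lebesgue_integral_def
    by (intro integral_cong_AE measurable_indicator_half_line)
      (auto elim!: eventually_mono simp: indicator_def)
  then show "1 / X * (LINT y:{1..X}|lebesgue. f y) = 1 / X * (LINT y:{1..X}|lebesgue. g y)"
    by simp
qed

lemma integrable_ess_bounded:
  assumes "ess_bounded f"
  shows "set_integrable lebesgue {1..X} f"
  unfolding set_integrable_def
proof (rule Bochner_Integration.integrable_bound)
  show "integrable lebesgue (\<lambda>x. ess_norm f * indicator {1..X} x :: real)"
    by (intro integrable_mult_right integrable_real_indicator)
       (auto simp: emeasure_lborel_Icc_eq)
  show "(\<lambda>x. indicator {1..X} x *\<^sub>R f x) \<in> borel_measurable lebesgue"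
    using assms by (intro measurable_indicator_half_line) (simp add: ess_bounded_def)
  have "AE x in lebesgue. x \<in> {1..} \<longrightarrow> \<bar>f x\<bar> \<le> ess_norm f"
    using ess_norm_AE[OF assms] by (simp add: AE_restrict_space_iff)
  then show "AE x in lebesgue. norm (indicator {1..X} x *\<^sub>R f x)
      \<le> norm (ess_norm f * indicator {1..X} x :: real)"
    by eventually_elim (auto simp: indicator_def)
qed

lemma mean_add: "mean X (f + g) = mean X f + mean X g"
  by transfer (simp add: ae_eq_def set_integral_add integrable_ess_bounded distrib_left)

lemma mean_scaleR: "mean X (r *\<^sub>R f) = r * mean X f"
  by transfer simp

lemma abs_mean_le:
  assumes "1 \<le> X"
  shows "\<bar>mean X f\<bar> \<le> norm f"
proof (transfer fixing: X, goal_cases)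
  case (1 f)
  then have f: "ess_bounded f" by (simp add: ae_eq_def)
  have "AE x in lebesgue. x \<in> {1..} \<longrightarrow> \<bar>f x\<bar> \<le> ess_norm f"
    using ess_norm_AE[OF f] by (simp add: AE_restrict_space_iff)
  then have "\<bar>LINT y:{1..X}|lebesgue. f y\<bar> \<le> (LINT y:{1..X}|lebesgue. ess_norm f)"
    unfolding set_lebesgue_integral_def
    using integrable_ess_bounded[OF f, of X] integrable_ess_bounded[OF ess_bounded_const, of X "ess_norm f"]
    by (intro integral_abs_bound[THEN order_trans] integral_mono_AE)
      (auto simp: set_integrable_def indicator_def elim!: eventually_mono)
  also have "\<dots> = (X - 1) * ess_norm f"
    using assms by (simp add: set_lebesgue_integral_def)
  also have "\<dots> \<le> X * ess_norm f"
    using esssup_ess_norm(2)[OF f] by (intro mult_right_mono) auto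
  finally show ?case using assms by (simp add: abs_mult field_simps)
qed

text \<open>For \<open>\<omega>\<close> the class of \<open>(\<eta>, t)\<close>, with \<open>\<theta> = 2 powr t\<close>.\<close>

lift_definition psi_fun :: "Omega \<Rightarrow> linf \<Rightarrow> real"
  is "\<lambda>(\<eta>, t) f. eta_lim \<eta> (\<lambda>n. mean (2 powr t * 2 ^ n) f)"
proof -
  fix p q assume "Omega_rel p q"
  then show "(case p of (\<eta>, t) \<Rightarrow> \<lambda>f. eta_lim \<eta> (\<lambda>n. mean (2 powr t * 2 ^ n) f)) =
      (case q of (\<eta>, t) \<Rightarrow> \<lambda>f. eta_lim \<eta> (\<lambda>n. mean (2 powr t * 2 ^ n) f))"
    by (rule Omega_rel_invariant) (simp add: eta_lim_tau)
qed

lift_definition psi :: "Omega \<Rightarrow> linf \<Rightarrow>\<^sub>L real" is psi_fun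
proof (rule bounded_linear_intro[where K = 1])
  fix \<omega> and r :: real and f g :: linf
  obtain \<eta> t where w: "0 \<le> t" "\<And>f. psi_fun \<omega> f = eta_lim \<eta> (\<lambda>n. mean (2 powr t * 2 ^ n) f)"
  proof -
    obtain p where abs: "\<omega> = Omega_class p" "Omega_rel p p"
      by (induction \<omega> rule: Omega.abs_induct) blast
    obtain \<eta> t where p: "p = (\<eta>, t)" by (cases p)
    show ?thesis
    proof (rule that)
      show "0 \<le> t" using abs by (simp add: Omega_rel_def p)
      show "psi_fun \<omega> f = eta_lim \<eta> (\<lambda>n. mean (2 powr t * 2 ^ n) f)" for f
        using abs by (simp add: psi_fun.abs_eq p)
    qed
  qed
  let ?X = "\<lambda>n. 2 powr t * 2 ^ n :: real"
  have bd: "\<bar>mean (?X n) f\<bar> \<le> norm f" for n f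
  proof (rule abs_mean_le)
    have "1 * 1 \<le> ?X n"
      using w(1) by (intro mult_mono) (auto simp: ge_one_powr_ge_zero)
    then show "1 \<le> ?X n" by simp
  qed
  have lim: "((\<lambda>n. mean (?X n) f) \<longlongrightarrow> psi_fun \<omega> f) (filter_of \<eta>)" for f
    unfolding w by (rule tendsto_eta_lim) (rule bd)
  show "psi_fun \<omega> (f + g) = psi_fun \<omega> f + psi_fun \<omega> g"
    unfolding w(2)[of "f + g"] mean_add by (rule eta_lim_eqI_tendsto) (intro tendsto_intros lim)
  show "psi_fun \<omega> (r *\<^sub>R f) = r *\<^sub>R psi_fun \<omega> f"
    unfolding w(2)[of "r *\<^sub>R f"] mean_scaleR real_scaleR_def
    by (rule eta_lim_eqI_tendsto) (intro tendsto_intros lim)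
  show "norm (psi_fun \<omega> f) \<le> norm f * 1"
    using tendsto_upperbound[OF tendsto_norm[OF lim] always_eventually filter_of_neq_bot,
        of f "norm f"] bd
    by simp
qed

lemma psi_Omega_class:
  assumes "t \<in> {0..1}" "ess_bounded f"
  shows "psi (Omega_class (\<eta>, t)) (linf_of f) =
    eta_lim \<eta> (\<lambda>n. 1 / (2 powr t * 2 ^ n) * (LINT y:{1..2 powr t * 2 ^ n}|lebesgue. f y))"
  using assms by (simp add: psi.rep_eq psi_fun.abs_eq Omega_rel_def mean.abs_eq ae_eq_def)

end

theory Submission
  imports Defs "HOL-Real_Asymp.Real_Asymp"
begin

text \<open>Substituting \<open>y = c x\<close> with \<open>c = 2 powr s\<close> turns the mean of \<open>P s f\<close> over \<open>[1, X]\<close> into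
  the mean of \<open>f\<close> over \<open>[1, c X]\<close>, up to the contribution of \<open>[1, c]\<close>, which is
  \<open>O(1 / X)\<close> and vanishes along every free ultrafilter. The right endpoints
  \<open>c \<theta> 2 ^ n\<close> are those occurring at \<open>flow s \<omega>\<close>, with the integer part of \<open>t + s\<close>
  absorbed by a shift of the index.\<close>

text \<open>Lebesgue measure is \<open>c\<close> times its image under multiplication by
  \<open>c\<close>: the density contributes the factor and the image measure the
  substitution.\<close>

lemma integral_lebesgue_real_scale:
  fixes f :: "real \<Rightarrow> real"
  assumes f: "f \<in> borel_measurable lebesgue" and c: "0 < c"
  shows "(LINT x|lebesgue. f x) = c * (LINT x|lebesgue. f (c * x))"
proof -
  have T: "(\<lambda>x. c * x) \<in> lebesgue \<rightarrow>\<^sub>M lebesgue"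
    using lebesgue_measurable_scaling[of c, where 'a = real] by (simp add: real_scaleR_def[abs_def])
  have "(LINT x|lebesgue. f x) =
      (LINT x|density (distr lebesgue lebesgue (\<lambda>x. c * x)) (\<lambda>x. ennreal \<bar>c\<bar>). f x)"
    using c by (subst lebesgue_real_scale[of c]) auto
  also have "\<dots> = (LINT x|distr lebesgue lebesgue (\<lambda>x. c * x). \<bar>c\<bar> *\<^sub>R f x)"
    using f by (intro integral_density) auto
  also have "\<dots> = (LINT x|lebesgue. \<bar>c\<bar> *\<^sub>R f (c * x))"
    using f by (intro integral_distr T) auto
  finally show ?thesis using c by simp
qed

text \<open>Split the integral over \<open>{1..c * X}\<close> at \<open>c = 2 powr s\<close>. The
  upper piece rescales to \<open>{1..X}\<close>; the lower one, divided by \<open>c * X\<close>, is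
  exactly \<open>mean c f / X\<close>.\<close>

lemma mean_dilate:
  assumes s: "0 \<le> s" and X: "1 \<le> X"
  shows "mean (2 powr s * X) f = mean X (dilate s f) + mean (2 powr s) f / X"
proof (transfer fixing: s X, goal_cases)
  case (1 f)
  define c :: real where "c = 2 powr s"
  have c: "1 \<le> c" using s by (simp add: c_def ge_one_powr_ge_zero)
  have cX: "c \<le> c * X" using c X by simp
  have f: "ess_bounded f" using 1 by (simp add: ae_eq_def)
  note int = integrable_ess_bounded[OF f]
  have int': "set_integrable lebesgue {c<..c * X} f"
    by (rule set_integrable_subset[OF int[of "c * X"]]) (use c in auto)
  \<comment> \<open>The upper piece is half-open so that the union is disjoint. After rescaling, the
    missing endpoint \<open>1\<close> is restored as a null set.\<close>
  have "{1..c * X} = {1..c} \<union> {c<..c * X}"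
    using c order_trans[OF _ cX] by fastforce
  then have "(LINT y:{1..c * X}|lebesgue. f y) =
      (LINT y:{1..c}|lebesgue. f y) + (LINT y:{c<..c * X}|lebesgue. f y)"
    using set_integral_Un[OF _ int int', of c] by (simp add: disjoint_iff)
  also have "(LINT y:{c<..c * X}|lebesgue. f y) =
      c * (LINT x|lebesgue. indicator {c<..c * X} (c * x) *\<^sub>R f (c * x))"
    unfolding set_lebesgue_integral_def
    using int' c by (intro integral_lebesgue_real_scale) (auto simp: set_integrable_def)
  also have "(\<lambda>x. indicator {c<..c * X} (c * x) *\<^sub>R f (c * x)) =
      (\<lambda>x. indicator {1<..X} x *\<^sub>R f (c * x))"
    using c by (auto simp: indicator_def)
  also have "(LINT x|lebesgue. indicator {1<..X} x *\<^sub>R f (c * x)) =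
      (LINT x:{1..X}|lebesgue. f (c * x))"
  proof -
    have i: "set_integrable lebesgue {1..X} (\<lambda>x. f (c * x))"
      by (rule integrable_ess_bounded) (rule ess_bounded_dilate[OF f c])
    have j: "set_integrable lebesgue {1<..X} (\<lambda>x. f (c * x))"
      by (rule set_integrable_subset[OF i]) auto
    have "{1::real} \<in> null_sets lebesgue" by (simp add: null_sets_completionI)
    then have "AE x in lebesgue. x \<notin> {1::real}" by (rule AE_not_in)
    then show ?thesis
      using i j unfolding set_lebesgue_integral_def set_integrable_def
      by (intro integral_cong_AE) (auto elim!: eventually_mono simp: indicator_def)
  qed
  finally show ?case
    using s c X unfolding c_def[symmetric] by (simp add: field_simps)
qed

text \<open>An ultrafilter containing some \<open>{n}\<close> is principal, so a free one contains
  every cofinite set. Ordinary limits of sequences therefore persist along it.\<close>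

lemma free_ultrafilter_le_sequentially:
  assumes "\<eta> \<in> free_ultrafilters"
  shows "filter_of \<eta> \<le> sequentially"
proof -
  have u: "is_ultrafilter (filter_of \<eta>)" using filter_of[of \<eta>] by simp
  have ne: "eventually (\<lambda>k. k \<noteq> n) (filter_of \<eta>)" for n
  proof (rule ccontr)
    assume "\<not> ?thesis"
    then have n: "eventually (\<lambda>k. k = n) (filter_of \<eta>)"
      using u[unfolded is_ultrafilter_def, THEN conjunct2, rule_format, of "{n}"] by simp
    have "eventually Q (filter_of \<eta>) \<longleftrightarrow> Q n" for Q
    proof -
      have "eventually Q (filter_of \<eta>) \<longleftrightarrow> eventually (\<lambda>k. Q n) (filter_of \<eta>)"
        by (rule eventually_cong[OF n]) simp
      then show ?thesis
        using filter_of_neq_bot[of \<eta>] by (cases "Q n") (auto simp: eventually_False)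
    qed
    then have "filter_of \<eta> = principal {n}"
      by (intro filter_eqI) (simp add: eventually_principal)
    then have "\<eta> = principal_ultrafilter n"
      by (metis filter_of_inject principal_ultrafilter.rep_eq)
    then show False using assms by (simp add: free_ultrafilters_def)
  qed
  show ?thesis unfolding cofinite_eq_sequentially[symmetric]
  proof (rule filter_leI)
    fix Q :: "nat \<Rightarrow> bool" assume "eventually Q cofinite"
    \<comment> \<open>Only finitely many exceptions \<open>n\<close> have to be avoided, so finitely
      many conditions \<open>k \<noteq> n\<close> combine.\<close>
    then have "eventually (\<lambda>k. \<forall>n\<in>{n. \<not> Q n}. k \<noteq> n) (filter_of \<eta>)"
      by (intro eventually_ball_finite) (auto simp: eventually_cofinite ne)
    then show "eventually Q (filter_of \<eta>)" by (rule eventually_mono) auto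
  qed
qed

lemma eta_lim_tau_funpow: "eta_lim ((tau ^^ m) \<eta>) a = eta_lim \<eta> (\<lambda>n. a (n + m))"
  by (induction m arbitrary: a) (simp_all add: eta_lim_tau)

lemma psi_Omega_class_mean:
  assumes "t \<in> {0..1}"
  shows "psi (Omega_class (\<eta>, t)) f = eta_lim \<eta> (\<lambda>n. mean (2 powr t * 2 ^ n) f)"
  using assms by (simp add: psi.rep_eq psi_fun.abs_eq Omega_rel_def)

text \<open>The flow moves the integer part \<open>m\<close> of \<open>t + s\<close> from the
  exponent into \<open>tau ^^ m\<close>, that is, into an index shift by \<open>m\<close>; the
  product of the two powers of \<open>2\<close> is unchanged.\<close>

lemma psi_flow_Omega_class:
  assumes "0 \<le> s" "t \<in> {0..1}"
  shows "psi (flow s (Omega_class (\<eta>, t))) f =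
    eta_lim \<eta> (\<lambda>n. mean (2 powr s * (2 powr t * 2 ^ n)) f)"
proof -
  define m where "m = nat \<lfloor>t + s\<rfloor>"
  \<comment> \<open>As \<open>t + s\<close> is nonnegative, \<open>tau_power\<close> is an iterate
    of \<open>tau\<close> and not of \<open>inv tau\<close>.\<close>
  have m: "\<lfloor>t + s\<rfloor> = int m" using assms by (simp add: m_def)
  have r: "t + s - real m \<in> {0..1}" using m by (simp, linarith)
  have "2 powr (t + s - real m) * 2 ^ (n + m) = 2 powr s * (2 powr t * 2 ^ n)" for n
    by (simp add: powr_diff powr_add powr_realpow power_add)
  then show ?thesis
    using assms(2) r
    by (simp add: flow_Omega_class m tau_power_def psi_Omega_class_mean eta_lim_tau_funpow)
qed

theorem theorem3p3:
  fixes s :: real and \<omega> :: Omega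
  assumes "0 \<le> s" and "\<omega> \<in> Omega_star"
  shows "dual_adjoint (P s) (psi \<omega>) = psi (flow s \<omega>) \<and>
    (\<forall>f. psi \<omega> (P s f) = psi (flow s \<omega>) f)"
proof -
  obtain \<eta> t where w: "\<omega> = Omega_class (\<eta>, t)" "\<eta> \<in> free_ultrafilters" "t \<in> {0..1}"
    using assms(2) by (auto simp: Omega_star_def)
  let ?X = "\<lambda>n. 2 powr t * 2 ^ n :: real"
  have X: "1 \<le> ?X n" for n
    using mult_mono[of 1 "2 powr t" 1 "2 ^ n :: real"] w(3) by (simp add: ge_one_powr_ge_zero)
  have eq: "psi \<omega> (P s f) = psi (flow s \<omega>) f" for f
  proof -
    \<comment> \<open>The numerator does not depend on \<open>n\<close>, while \<open>?X n\<close>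
      grows geometrically.\<close>
    have "((\<lambda>n. mean (2 powr s) f / ?X n) \<longlongrightarrow> 0) sequentially"
      by real_asymp
    then have "((\<lambda>n. mean (2 powr s) f / ?X n) \<longlongrightarrow> 0) (filter_of \<eta>)"
      using free_ultrafilter_le_sequentially[OF w(2)] by (rule tendsto_mono[rotated])
    \<comment> \<open>This sequence need not converge in the ordinary sense; boundedness by
      \<open>norm (dilate s f)\<close> gives its limit along \<open>\<eta>\<close>.\<close>
    moreover have "((\<lambda>n. mean (?X n) (dilate s f)) \<longlongrightarrow>
        eta_lim \<eta> (\<lambda>n. mean (?X n) (dilate s f))) (filter_of \<eta>)"
      by (rule tendsto_eta_lim) (rule abs_mean_le[OF X])
    ultimately have "((\<lambda>n. mean (2 powr s * ?X n) f) \<longlongrightarrow>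
        eta_lim \<eta> (\<lambda>n. mean (?X n) (dilate s f)) + 0) (filter_of \<eta>)"
      unfolding mean_dilate[OF assms(1) X] by (intro tendsto_add)
    then have "eta_lim \<eta> (\<lambda>n. mean (2 powr s * ?X n) f) =
        eta_lim \<eta> (\<lambda>n. mean (?X n) (dilate s f))"
      by (simp add: eta_lim_eqI_tendsto)
    then show ?thesis
      using assms(1) w(1,3)
      by (simp add: psi_flow_Omega_class psi_Omega_class_mean P.rep_eq)
  qed
  then show ?thesis
    by (auto simp: dual_adjoint_def intro!: blinfun_eqI)
qed

end
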